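(* Let $G^t$ be an undirected graph on $[d]$, $p^t$ a probability distribution on $[d]$, $\gamma>0$ and $\gamma'=\gamma/3$. In the double-threshold freezing procedure, the total probability frozen in the propagation steps is at most three times the total probability frozen at the initial step: $$\sum_{i\in\bigcup_{k\ge1}F_k^t}p_i^t\le3\sum_{i\in F_0^t}p_i^t.$$
   Context: For $i\in[d]$, $N_i^t$ is the set consisting of $i$ and its neighbours in $G^t$. **Double-threshold freezing procedure:** the initial step freezes $F_0^t=\{i:\sum_{j\in N_i^t}p_j^t<\gamma\}$; for $k\ge1$, the $k$-th propagation step freezes $$F_k^t=\Big\{i\notin\bigcup_{m=0}^{k-1}F_m^t:\ \sum_{j\in N_i^t\setminus\bigcup_{m=0}^{k-1}F_m^t}p_j^t<\gamma'\Big\}.$$ *)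

theory Defs
  imports "HOL-Probability.Probability_Mass_Function"
begin

text \<open>Undirected graphs are symmetric edge relations on the vertex set \<open>{1..d}\<close>.
  Loops are neither required nor forbidden; they do not affect closed neighbourhoods.\<close>

definition undirected_graph_on :: "nat \<Rightarrow> (nat \<times> nat) set \<Rightarrow> bool" where
  "undirected_graph_on d E \<longleftrightarrow> E \<subseteq> {1..d} \<times> {1..d} \<and> sym E"

definition closed_nbhd :: "(nat \<times> nat) set \<Rightarrow> nat \<Rightarrow> nat set" where
  "closed_nbhd E i = insert i {j. (i, j) \<in> E}"

text \<open>\<open>frozen d E p \<gamma> \<gamma>' k\<close> is the set of vertices frozen exactly at step \<open>k\<close>.\<close>

fun frozen ::
  "nat \<Rightarrow> (nat \<times> nat) set \<Rightarrow> nat pmf \<Rightarrow> real \<Rightarrow> real \<Rightarrow> nat \<Rightarrow> nat set" where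
  "frozen d E p \<gamma> \<gamma>' 0 = {i \<in> {1..d}. (\<Sum>j\<in>closed_nbhd E i. pmf p j) < \<gamma>}"
| "frozen d E p \<gamma> \<gamma>' (Suc n) =
     {i \<in> {1..d}. i \<notin> (\<Union>m\<in>{0..n}. frozen d E p \<gamma> \<gamma>' m) \<and>
        (\<Sum>j\<in>closed_nbhd E i - (\<Union>m\<in>{0..n}. frozen d E p \<gamma> \<gamma>' m). pmf p j) < \<gamma>'}"

end

theory Submission
  imports Defs
begin

text \<open>Write \<open>U\<close> for the vertices frozen by propagation and count mass on the edges inside
  \<open>F\<^sub>0 \<union> U\<close>. A vertex of \<open>U\<close> has closed neighbourhood of mass at least \<open>\<gamma>\<close> but sees less than
  \<open>\<gamma>/3\<close> outside the previously frozen set, hence more than \<open>2\<gamma>/3\<close> inside it. Weighting each edge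
  by the product of its endpoint masses, the edges within \<open>U\<close> contribute at most \<open>\<gamma>/3 \<cdot> p(U)\<close>
  when charged to the endpoint frozen first. The remaining weight, at least \<open>\<gamma>/3 \<cdot> p(U)\<close>, lies
  between \<open>U\<close> and \<open>F\<^sub>0\<close>, where it is at most \<open>\<gamma> \<cdot> p(F\<^sub>0)\<close>.\<close>

lemma sum_frozen_mass_le:
  fixes p :: "'a \<Rightarrow> real" and N :: "'a \<Rightarrow> 'a set" and time :: "'a \<Rightarrow> nat"
  assumes fin: "finite F" "finite U" "\<And>i. finite (N i)"
    and nonneg: "\<And>i. 0 \<le> p i"
    and sym: "\<And>i j. j \<in> N i \<longleftrightarrow> i \<in> N j"
    and disj: "F \<inter> U = {}"
    and F: "\<And>i. i \<in> F \<Longrightarrow> sum p (N i) \<le> \<gamma>"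
    and U: "\<And>i. i \<in> U \<Longrightarrow> \<gamma> \<le> sum p (N i)"
    and step: "\<And>i. i \<in> U \<Longrightarrow> sum p (N i - (F \<union> {j\<in>U. time j < time i})) \<le> \<gamma> / 3"
    and "\<gamma> > 0"
  shows "sum p U \<le> 3 * sum p F"
proof -
  \<comment> \<open>Vertices of \<open>U\<close> tied with \<open>i\<close> in time, and
    \<open>i\<close> itself, stay outside \<open>B i\<close>: the strict inequality matches a test
    that removes only what was frozen in earlier steps.\<close>
  define B where "B i = {j\<in>U. time j < time i}" for i
  \<comment> \<open>Double counting of the edge weight \<open>p i * p j\<close> between
    \<open>A\<close> and \<open>C\<close>, by symmetry of \<open>N\<close>. \<open>R\<close> keeps
    its argument order, so "j earlier than i" seen from \<open>i\<close> becomes "i later than j"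
    seen from \<open>j\<close>.\<close>
  have swap: "(\<Sum>i\<in>A. p i * sum p {j\<in>C. j \<in> N i \<and> R i j})
      = (\<Sum>j\<in>C. p j * sum p {i\<in>A. i \<in> N j \<and> R i j})"
    if "finite A" "finite C" for A C and R :: "'a \<Rightarrow> 'a \<Rightarrow> bool"
  proof -
    have "(\<Sum>i\<in>A. p i * sum p {j\<in>C. j \<in> N i \<and> R i j})
        = (\<Sum>i\<in>A. \<Sum>j\<in>C. if j \<in> N i \<and> R i j then p i * p j else 0)"
      using that
      by (intro sum.cong refl) (auto simp: sum_distrib_left sum.inter_filter intro!: sum.cong)
    also have "\<dots> = (\<Sum>j\<in>C. \<Sum>i\<in>A. if j \<in> N i \<and> R i j then p i * p j else 0)"
      by (rule sum.swap)
    also have "\<dots> = (\<Sum>j\<in>C. \<Sum>i\<in>A. if i \<in> N j \<and> R i j then p j * p i else 0)"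
      using sym by (intro sum.cong refl) (auto simp: mult.commute)
    also have "\<dots> = (\<Sum>j\<in>C. p j * sum p {i\<in>A. i \<in> N j \<and> R i j})"
      using that
      by (intro sum.cong refl) (auto simp: sum_distrib_left sum.inter_filter intro!: sum.cong)
    finally show ?thesis .
  qed
  \<comment> \<open>The bound is \<gamma> - \<gamma>/3. The conjunct \<open>True\<close> gives the
    sum over \<open>F\<close> the shape of \<open>swap\<close> with trivial
    \<open>R\<close>.\<close>
  have lower: "2 * \<gamma> / 3 \<le> sum p {j\<in>F. j \<in> N i \<and> True}
      + sum p {j\<in>U. j \<in> N i \<and> time j < time i}" if i: "i \<in> U" for i
  proof -
    have "sum p (N i) = sum p (N i - (F \<union> B i)) + sum p (N i \<inter> (F \<union> B i))"
      using fin(3) by (metis add.commute sum.Int_Diff)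
    moreover have "sum p (N i \<inter> (F \<union> B i))
        = sum p {j\<in>F. j \<in> N i \<and> True} + sum p {j\<in>U. j \<in> N i \<and> time j < time i}"
      using fin disj
      by (subst sum.union_disjoint[symmetric]) (auto simp: B_def intro!: sum.cong)
    ultimately show ?thesis using U[OF i] step[OF i] by (simp add: B_def)
  qed
  have "2 * \<gamma> / 3 * sum p U = (\<Sum>i\<in>U. p i * (2 * \<gamma> / 3))"
    unfolding sum_distrib_left by (simp only: mult.commute)
  also have "\<dots> \<le> (\<Sum>i\<in>U. p i * (sum p {j\<in>F. j \<in> N i \<and> True}
      + sum p {j\<in>U. j \<in> N i \<and> time j < time i}))"
    using lower nonneg by (intro sum_mono mult_left_mono) auto
  also have "\<dots> = (\<Sum>j\<in>F. p j * sum p {i\<in>U. i \<in> N j \<and> True})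
      + (\<Sum>j\<in>U. p j * sum p {i\<in>U. i \<in> N j \<and> time j < time i})"
    unfolding distrib_left sum.distrib
    using swap[OF fin(2,1), of "\<lambda>_ _. True"]
      swap[OF fin(2,2), of "\<lambda>i j. time j < time i"] by simp
  also have "\<dots> \<le> (\<Sum>j\<in>F. p j * \<gamma>) + (\<Sum>j\<in>U. p j * (\<gamma> / 3))"
  proof (intro add_mono sum_mono mult_left_mono nonneg)
    fix j assume "j \<in> F"
    have "sum p {i\<in>U. i \<in> N j \<and> True} \<le> sum p (N j)"
      using fin nonneg by (intro sum_mono2) auto
    then show "sum p {i\<in>U. i \<in> N j \<and> True} \<le> \<gamma>" using F[OF \<open>j \<in> F\<close>] by linarith
  next
    \<comment> \<open>Neighbours frozen later than \<open>j\<close> lie outside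
      \<open>F \<union> B j\<close>, so the test that \<open>j\<close> itself passed bounds their
      mass.\<close>
    fix j assume "j \<in> U"
    have "sum p {i\<in>U. i \<in> N j \<and> time j < time i} \<le> sum p (N j - (F \<union> B j))"
      using fin nonneg disj by (intro sum_mono2) (auto simp: B_def)
    then show "sum p {i\<in>U. i \<in> N j \<and> time j < time i} \<le> \<gamma> / 3"
      using step[OF \<open>j \<in> U\<close>] by (simp add: B_def)
  qed
  also have "\<dots> = \<gamma> * sum p F + \<gamma> / 3 * sum p U"
    by (simp add: sum_distrib_left mult.commute)
  finally have "\<gamma> * sum p U \<le> \<gamma> * (3 * sum p F)"
    by (simp add: field_simps)
  then show ?thesis using \<open>\<gamma> > 0\<close> by simp
qed

lemma frozen_subset: "frozen d E p \<gamma> \<gamma>' k \<subseteq> {1..d}"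
  by (cases k) auto

lemma frozen_disjoint:
  assumes "i \<in> frozen d E p \<gamma> \<gamma>' n" "m < n"
  shows "i \<notin> frozen d E p \<gamma> \<gamma>' m"
proof -
  obtain n' where "n = Suc n'" using assms(2) by (cases n) auto
  with assms show ?thesis by auto
qed

theorem claim3p2:
  fixes d :: nat and E :: "(nat \<times> nat) set" and p :: "nat pmf" and \<gamma> \<gamma>' :: real
  assumes "undirected_graph_on d E"
    and "set_pmf p \<subseteq> {1..d}"
    and "\<gamma> > 0"
    and "\<gamma>' = \<gamma> / 3"
  shows "(\<Sum>i\<in>(\<Union>k\<in>{1..}. frozen d E p \<gamma> \<gamma>' k). pmf p i)
           \<le> 3 * (\<Sum>i\<in>frozen d E p \<gamma> \<gamma>' 0. pmf p i)"
proof -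
  let ?F = "frozen d E p \<gamma> \<gamma>'"
  let ?U = "\<Union>k\<in>{1..}. ?F k"
  \<comment> \<open>The freezing step of \<open>i\<close>, unique because the stages are disjoint.
    It is evaluated only at frozen vertices.\<close>
  define time where "time i = (THE k. i \<in> ?F k)" for i
  have time_eq: "time i = k" if "i \<in> ?F k" for i k
    unfolding time_def using that frozen_disjoint
    by (metis (no_types, lifting) nat_neq_iff the_equality)
  have E: "E \<subseteq> {1..d} \<times> {1..d}" "sym E"
    using assms(1) by (auto simp: undirected_graph_on_def)
  \<comment> \<open>Rewrites the set removed at step \<open>Suc n\<close> in the form the counting
    lemma expects, with stage 0 split off since \<open>?U\<close> starts at stage 1.\<close>
  have earlier: "(\<Union>m\<in>{0..n}. ?F m) = ?F 0 \<union> {j\<in>?U. time j < Suc n}" for n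
  proof (intro equalityI subsetI)
    fix j assume "j \<in> (\<Union>m\<in>{0..n}. ?F m)"
    then obtain m where "m \<le> n" "j \<in> ?F m" by auto
    then show "j \<in> ?F 0 \<union> {j\<in>?U. time j < Suc n}"
      using time_eq[of j m] by (cases "m = 0") (auto intro!: bexI[of _ m] simp del: frozen.simps)
  next
    fix j assume "j \<in> ?F 0 \<union> {j\<in>?U. time j < Suc n}"
    then show "j \<in> (\<Union>m\<in>{0..n}. ?F m)"
      using time_eq[of j] by (auto simp del: frozen.simps simp: less_Suc_eq_le)
  qed
  show ?thesis
  proof (rule sum_frozen_mass_le[where N = "closed_nbhd E" and time = time and \<gamma> = \<gamma>])
    show "finite (?F 0)" "finite ?U"
      by (auto intro!: finite_subset[OF _ finite_atLeastAtMost[of 1 d]] dest: subsetD[OF frozen_subset]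
          simp del: frozen.simps)
    show "finite (closed_nbhd E i)" for i
    proof -
      have "{j. (i, j) \<in> E} \<subseteq> {1..d}" using E(1) by auto
      then show ?thesis by (simp add: closed_nbhd_def finite_subset)
    qed
    show "j \<in> closed_nbhd E i \<longleftrightarrow> i \<in> closed_nbhd E j" for i j
      using E(2) by (auto simp: closed_nbhd_def dest: symD)
    show "?F 0 \<inter> ?U = {}"
      using frozen_disjoint by (fastforce simp del: frozen.simps)
    show "sum (pmf p) (closed_nbhd E i) \<le> \<gamma>" if "i \<in> ?F 0" for i
      using that by simp
  next
    fix i assume "i \<in> ?U"
    then obtain n where n: "i \<in> ?F (Suc n)"
      by (auto simp del: frozen.simps simp: Suc_le_eq dest!: gr0_implies_Suc)
    \<comment> \<open>A vertex of \<open>{1..d}\<close> outside \<open>?F 0\<close> has failed the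
      initial test, which gives the lower bound \<gamma>.\<close>
    have "i \<in> {1..d}" using n by simp
    moreover have "i \<notin> ?F 0" using frozen_disjoint[OF n] by blast
    ultimately show "\<gamma> \<le> sum (pmf p) (closed_nbhd E i)" by auto
    show "sum (pmf p) (closed_nbhd E i - (?F 0 \<union> {j\<in>?U. time j < time i})) \<le> \<gamma> / 3"
      using n unfolding time_eq[OF n] earlier[symmetric] assms(4)[symmetric] by simp
  qed (use assms(3) in auto)
qed

end
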